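(* The proof system $\mathbb{IRIT}$ is sound and strongly complete with respect to the class of reflexive proper bi-frames. That is, for every set $\Gamma$ of formulas and every formula $\varphi$ of the language $\mathbf{IRI}$: $\Gamma\vdash_{\mathbb{IRIT}}\varphi$ if and only if $\Gamma\vDash_F\varphi$, where $F$ is the class of all reflexive proper bi-frames.
   Context: Language. Fix a nonempty set $\mathbf{P}$ of propositional variables. The formulas of the language $\mathbf{IRI}$ are given by $\varphi::=p\mid\neg\varphi\mid(\varphi\land\varphi)\mid I\varphi\mid I^R\varphi$ with $p\in\mathbf{P}$. Other Boolean connectives $\vee,\to,\leftrightarrow,\top,\bot$ are defined as usual. Bi-semantics. A bi-frame is a triple $\langle S,R,R^\bullet\rangle$ with $S$ a nonempty set and $R,R^\bullet$ binary relations on $S$; a bi-model $\mathcal{M}=\langle S,R,R^\bullet,V\rangle$ is a bi-frame with a valuation $V:\mathbf{P}\to\mathcal{P}(S)$. A bi-frame is proper if $R\subseteq R^\bullet$; it is reflexive if both $R$ and $R^\bullet$ are reflexive. Truth at $s\in S$: $\mathcal{M},s\vDash p$ iff $s\in V(p)$; $\neg,\land$ are interpreted classically; $\mathcal{M},s\vDash I\varphi$ iff there is $t$ with $sRt$ and $\mathcal{M},t\vDash\varphi$, and there is $u$ with $sRu$ and $\mathcal{M},u\nvDash\varphi$; $\mathcal{M},s\vDash I^R\varphi$ iff $\mathcal{M},s\vDash I\varphi$ and there is $t$ with $sR^\bullet t$ and $\mathcal{M},t\nvDash I\varphi$. For a class $F$ of bi-frames, $\Gamma\vDash_F\varphi$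 means: for every bi-model $\mathcal{M}$ based on a bi-frame in $F$ and every state $s$ of $\mathcal{M}$, if $\mathcal{M},s\vDash\gamma$ for all $\gamma\in\Gamma$, then $\mathcal{M},s\vDash\varphi$. Proof systems. $\mathbb{IRIK}$ has the axioms: all instances of propositional tautologies; $I\varphi\leftrightarrow I\neg\varphi$; $I^R\varphi\leftrightarrow I^R\neg\varphi$; $I(\varphi\land\psi)\to(I\varphi\vee I\psi)$; $I(\varphi\vee\psi)\land I(\neg\varphi\vee\chi)\to I\varphi$; $I^R\varphi\to I\varphi$; $I\varphi\land I(I\varphi\vee\chi)\to I^R\varphi$; and the rules: modus ponens; from $\varphi$ infer $\neg I\varphi$; from $\varphi\leftrightarrow\psi$ infer $I\varphi\leftrightarrow I\psi$; from $\varphi\leftrightarrow\psi$ infer $I^R\varphi\leftrightarrow I^R\psi$; for every $n\in\mathbb{N}$, from $I\chi_1\land\cdots\land I\chi_n\to I\varphi$ infer $(\neg I^R\chi_1\land I\chi_1)\land\cdots\land(\neg I^R\chi_n\land I\chi_n)\to\neg I^R\varphi$. $\mathbb{IRIT}$ is $\mathbb{IRIK}$ plus the axiom schema $\varphi\land I(\varphi\vee\psi)\to I\varphi$. Theoremhood ($\vdash\varphi$) is as usual, and $\Gamma\vdash\varphi$ means that $\vdash\gamma_1\land\cdots\land\gamma_k\to\varphi$ for some finitely many $\gamma_1,\dots,\gamma_k\in\Gamma$. *)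

theory Defs
  imports Main
begin

section \<open>Language\<close>

text \<open>The propositional variables are the elements of an arbitrary type \<open>'p\<close>; types are nonempty.\<close>

datatype 'p fm =
    Var 'p
  | Neg "'p fm"  (\<open>\<^bold>\<not> _\<close> [70] 70)
  | And "'p fm" "'p fm"  (infixr \<open>\<^bold>\<and>\<close> 65)
  | Ign "'p fm"
  | IgnR "'p fm"

abbreviation Or :: "'p fm \<Rightarrow> 'p fm \<Rightarrow> 'p fm"  (infixr \<open>\<^bold>\<or>\<close> 60) where
  "\<phi> \<^bold>\<or> \<psi> \<equiv> \<^bold>\<not> (\<^bold>\<not> \<phi> \<^bold>\<and> \<^bold>\<not> \<psi>)"

abbreviation Imp :: "'p fm \<Rightarrow> 'p fm \<Rightarrow> 'p fm"  (infixr \<open>\<^bold>\<longrightarrow>\<close> 55) where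
  "\<phi> \<^bold>\<longrightarrow> \<psi> \<equiv> \<^bold>\<not> (\<phi> \<^bold>\<and> \<^bold>\<not> \<psi>)"

abbreviation Equ :: "'p fm \<Rightarrow> 'p fm \<Rightarrow> 'p fm"  (infix \<open>\<^bold>\<longleftrightarrow>\<close> 50) where
  "\<phi> \<^bold>\<longleftrightarrow> \<psi> \<equiv> (\<phi> \<^bold>\<longrightarrow> \<psi>) \<^bold>\<and> (\<psi> \<^bold>\<longrightarrow> \<phi>)"

text \<open>The constant \<open>undefined\<close> serves as an arbitrary but fixed propositional variable.\<close>

definition Top :: "'p fm" where
  "Top = Var undefined \<^bold>\<or> \<^bold>\<not> Var undefined"

fun Conj :: "'p fm list \<Rightarrow> 'p fm" where
  "Conj [] = Top"
| "Conj [\<phi>] = \<phi>"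
| "Conj (\<phi> # \<psi> # \<phi>s) = \<phi> \<^bold>\<and> Conj (\<psi> # \<phi>s)"

section \<open>Bi-semantics\<close>

record 's biframe =
  states :: "'s set"
  rel :: "'s rel"
  brel :: "'s rel"

definition is_biframe :: "'s biframe \<Rightarrow> bool" where
  "is_biframe F \<longleftrightarrow> states F \<noteq> {} \<and>
     rel F \<subseteq> states F \<times> states F \<and> brel F \<subseteq> states F \<times> states F"

definition proper :: "'s biframe \<Rightarrow> bool" where
  "proper F \<longleftrightarrow> rel F \<subseteq> brel F"

definition reflexive :: "'s biframe \<Rightarrow> bool" where
  "reflexive F \<longleftrightarrow> refl_on (states F) (rel F) \<and> refl_on (states F) (brel F)"

definition reflexive_proper_biframes :: "'s biframe set" where
  "reflexive_proper_biframes = {F. is_biframe F \<and> reflexive F \<and> proper F}"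

definition is_valuation :: "'s biframe \<Rightarrow> ('p \<Rightarrow> 's set) \<Rightarrow> bool" where
  "is_valuation F V \<longleftrightarrow> (\<forall>p. V p \<subseteq> states F)"

text \<open>The clause for \<open>IgnR \<phi>\<close> refers to the truth of \<open>Ign \<phi>\<close>, which is not a subformula; the
  following measure justifies the recursion.\<close>

primrec weight :: "'p fm \<Rightarrow> nat" where
  "weight (Var p) = 0"
| "weight (\<^bold>\<not> \<phi>) = weight \<phi> + 1"
| "weight (\<phi> \<^bold>\<and> \<psi>) = weight \<phi> + weight \<psi> + 1"
| "weight (Ign \<phi>) = weight \<phi> + 1"
| "weight (IgnR \<phi>) = weight \<phi> + 2"

text \<open>A bi-model is given by a bi-frame \<open>F\<close> together with a valuation \<open>V\<close>.\<close>

function truth :: "'s biframe \<Rightarrow> ('p \<Rightarrow> 's set) \<Rightarrow> 's \<Rightarrow> 'p fm \<Rightarrow> bool" where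
  "truth F V s (Var p) \<longleftrightarrow> s \<in> V p"
| "truth F V s (\<^bold>\<not> \<phi>) \<longleftrightarrow> \<not> truth F V s \<phi>"
| "truth F V s (\<phi> \<^bold>\<and> \<psi>) \<longleftrightarrow> truth F V s \<phi> \<and> truth F V s \<psi>"
| "truth F V s (Ign \<phi>) \<longleftrightarrow>
     (\<exists>t. (s, t) \<in> rel F \<and> truth F V t \<phi>) \<and> (\<exists>u. (s, u) \<in> rel F \<and> \<not> truth F V u \<phi>)"
| "truth F V s (IgnR \<phi>) \<longleftrightarrow>
     truth F V s (Ign \<phi>) \<and> (\<exists>t. (s, t) \<in> brel F \<and> \<not> truth F V t (Ign \<phi>))"
  by pat_completeness auto
termination
  by (relation "measure (\<lambda>(F, V, s, \<phi>). weight \<phi>)") auto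

text \<open>All frames in \<open>C\<close> have their states in one type \<open>'s\<close>, since HOL does not quantify over types
  inside a formula. Claims about every frame whatsoever are made polymorphically in \<open>'s\<close>.\<close>

definition consequence :: "'p fm set \<Rightarrow> 's biframe set \<Rightarrow> 'p fm \<Rightarrow> bool"
  (\<open>_ \<TTurnstile>\<^bsub>_\<^esub> _\<close> [50, 0, 50] 50) where
  "\<Gamma> \<TTurnstile>\<^bsub>C\<^esub> \<phi> \<longleftrightarrow>
     (\<forall>F \<in> C. \<forall>V. is_valuation F V \<longrightarrow>
        (\<forall>s \<in> states F. (\<forall>\<gamma> \<in> \<Gamma>. truth F V s \<gamma>) \<longrightarrow> truth F V s \<phi>))"

section \<open>Proof systems\<close>

text \<open>Propositional tautologies are written over a separate countable supply of letters, since there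
  may be only finitely many propositional variables.\<close>

datatype pl = PVar nat | PNeg pl | PAnd pl pl

primrec pl_eval :: "(nat \<Rightarrow> bool) \<Rightarrow> pl \<Rightarrow> bool" where
  "pl_eval v (PVar n) \<longleftrightarrow> v n"
| "pl_eval v (PNeg \<alpha>) \<longleftrightarrow> \<not> pl_eval v \<alpha>"
| "pl_eval v (PAnd \<alpha> \<beta>) \<longleftrightarrow> pl_eval v \<alpha> \<and> pl_eval v \<beta>"

primrec pl_inst :: "(nat \<Rightarrow> 'p fm) \<Rightarrow> pl \<Rightarrow> 'p fm" where
  "pl_inst \<sigma> (PVar n) = \<sigma> n"
| "pl_inst \<sigma> (PNeg \<alpha>) = \<^bold>\<not> pl_inst \<sigma> \<alpha>"
| "pl_inst \<sigma> (PAnd \<alpha> \<beta>) = pl_inst \<sigma> \<alpha> \<^bold>\<and> pl_inst \<sigma> \<beta>"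

definition pl_tautology :: "pl \<Rightarrow> bool" where
  "pl_tautology \<alpha> \<longleftrightarrow> (\<forall>v. pl_eval v \<alpha>)"

inductive IRIK_axiom :: "'p fm \<Rightarrow> bool" where
  Taut: "pl_tautology \<alpha> \<Longrightarrow> IRIK_axiom (pl_inst \<sigma> \<alpha>)"
| I_neg: "IRIK_axiom (Ign \<phi> \<^bold>\<longleftrightarrow> Ign (\<^bold>\<not> \<phi>))"
| IR_neg: "IRIK_axiom (IgnR \<phi> \<^bold>\<longleftrightarrow> IgnR (\<^bold>\<not> \<phi>))"
| I_and: "IRIK_axiom (Ign (\<phi> \<^bold>\<and> \<psi>) \<^bold>\<longrightarrow> (Ign \<phi> \<^bold>\<or> Ign \<psi>))"
| I_or: "IRIK_axiom ((Ign (\<phi> \<^bold>\<or> \<psi>) \<^bold>\<and> Ign (\<^bold>\<not> \<phi> \<^bold>\<or> \<chi>)) \<^bold>\<longrightarrow> Ign \<phi>)"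
| IR_I: "IRIK_axiom (IgnR \<phi> \<^bold>\<longrightarrow> Ign \<phi>)"
| I_IR: "IRIK_axiom ((Ign \<phi> \<^bold>\<and> Ign (Ign \<phi> \<^bold>\<or> \<chi>)) \<^bold>\<longrightarrow> IgnR \<phi>)"

inductive IRIT_axiom :: "'p fm \<Rightarrow> bool" where
  IRIK: "IRIK_axiom \<phi> \<Longrightarrow> IRIT_axiom \<phi>"
| T: "IRIT_axiom ((\<phi> \<^bold>\<and> Ign (\<phi> \<^bold>\<or> \<psi>)) \<^bold>\<longrightarrow> Ign \<phi>)"

text \<open>Theoremhood from a set of axioms by the rules common to both systems. In \<open>Mix\<close>, the premise
  and the conclusion have the antecedent \<open>Top\<close> if the list \<open>\<chi>s\<close> is empty.\<close>

inductive thm_from :: "('p fm \<Rightarrow> bool) \<Rightarrow> 'p fm \<Rightarrow> bool" for Ax :: "'p fm \<Rightarrow> bool" where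
  Axiom: "Ax \<phi> \<Longrightarrow> thm_from Ax \<phi>"
| MP: "thm_from Ax (\<phi> \<^bold>\<longrightarrow> \<psi>) \<Longrightarrow> thm_from Ax \<phi> \<Longrightarrow> thm_from Ax \<psi>"
| Not_I: "thm_from Ax \<phi> \<Longrightarrow> thm_from Ax (\<^bold>\<not> Ign \<phi>)"
| I_cong: "thm_from Ax (\<phi> \<^bold>\<longleftrightarrow> \<psi>) \<Longrightarrow> thm_from Ax (Ign \<phi> \<^bold>\<longleftrightarrow> Ign \<psi>)"
| IR_cong: "thm_from Ax (\<phi> \<^bold>\<longleftrightarrow> \<psi>) \<Longrightarrow> thm_from Ax (IgnR \<phi> \<^bold>\<longleftrightarrow> IgnR \<psi>)"
| Mix: "thm_from Ax (Conj (map Ign \<chi>s) \<^bold>\<longrightarrow> Ign \<phi>) \<Longrightarrow>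
    thm_from Ax (Conj (map (\<lambda>\<chi>. \<^bold>\<not> IgnR \<chi> \<^bold>\<and> Ign \<chi>) \<chi>s) \<^bold>\<longrightarrow> \<^bold>\<not> IgnR \<phi>)"

definition derives_IRIT :: "'p fm set \<Rightarrow> 'p fm \<Rightarrow> bool"  (infix \<open>\<turnstile>\<^sub>I\<^sub>R\<^sub>I\<^sub>T\<close> 50) where
  "\<Gamma> \<turnstile>\<^sub>I\<^sub>R\<^sub>I\<^sub>T \<phi> \<longleftrightarrow> (\<exists>\<gamma>s. set \<gamma>s \<subseteq> \<Gamma> \<and> thm_from IRIT_axiom (Conj \<gamma>s \<^bold>\<longrightarrow> \<phi>))"

end

theory Submission
  imports Defs
begin

text \<open>Completeness uses a canonical model whose states are the maximal consistent sets. Over the axiom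
  \<open>T\<close>, the formula \<open>\<phi> \<^bold>\<and> \<^bold>\<not> Ign \<phi>\<close> behaves like a normal necessity of \<open>\<phi>\<close>, and \<open>rel\<close> is its usual
  canonical relation. The relation \<open>brel\<close> links \<open>s\<close> to \<open>t\<close> if \<open>t\<close> contains \<open>Ign \<chi>\<close> for every \<open>\<chi>\<close> with
  \<open>Ign \<chi> \<^bold>\<and> \<^bold>\<not> IgnR \<chi> \<in> s\<close>; the rule \<open>Mix\<close> is exactly the existence lemma for it, and the axiom
  \<open>I_IR\<close> makes the frame proper.\<close>

section \<open>Propositional reasoning\<close>

text \<open>One notion covers truth at a state, membership in a maximal consistent set and
  evaluation of a propositional skeleton; \<open>Ign\<close> and \<open>IgnR\<close> formulas count
  as atoms.\<close>

definition boolean_hom :: "('p fm \<Rightarrow> bool) \<Rightarrow> bool" where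
  "boolean_hom h \<longleftrightarrow> (\<forall>\<phi>. h (\<^bold>\<not> \<phi>) \<longleftrightarrow> \<not> h \<phi>) \<and> (\<forall>\<phi> \<psi>. h (\<phi> \<^bold>\<and> \<psi>) \<longleftrightarrow> h \<phi> \<and> h \<psi>)"

lemma boolean_hom_Neg [simp]: "boolean_hom h \<Longrightarrow> h (\<^bold>\<not> \<phi>) \<longleftrightarrow> \<not> h \<phi>"
  and boolean_hom_And [simp]: "boolean_hom h \<Longrightarrow> h (\<phi> \<^bold>\<and> \<psi>) \<longleftrightarrow> h \<phi> \<and> h \<psi>"
  by (auto simp: boolean_hom_def)

lemma boolean_hom_Top [simp]: "boolean_hom h \<Longrightarrow> h Top"
  by (simp add: Top_def)

lemma boolean_hom_Conj [simp]: "boolean_hom h \<Longrightarrow> h (Conj \<phi>s) \<longleftrightarrow> (\<forall>\<phi>\<in>set \<phi>s. h \<phi>)"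
  by (induction \<phi>s rule: Conj.induct) auto

lemma boolean_hom_pl_inst: "boolean_hom h \<Longrightarrow> h (pl_inst \<sigma> \<alpha>) \<longleftrightarrow> pl_eval (h \<circ> \<sigma>) \<alpha>"
  by (induction \<alpha>) auto

lemma boolean_hom_truth: "boolean_hom (truth F V s)"
  by (simp add: boolean_hom_def)

primrec pl_abs :: "('p fm \<Rightarrow> nat) \<Rightarrow> 'p fm \<Rightarrow> pl" where
  "pl_abs f (Var p) = PVar (f (Var p))"
| "pl_abs f (\<^bold>\<not> \<phi>) = PNeg (pl_abs f \<phi>)"
| "pl_abs f (\<phi> \<^bold>\<and> \<psi>) = PAnd (pl_abs f \<phi>) (pl_abs f \<psi>)"
| "pl_abs f (Ign \<phi>) = PVar (f (Ign \<phi>))"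
| "pl_abs f (IgnR \<phi>) = PVar (f (IgnR \<phi>))"

primrec boolean_atoms :: "'p fm \<Rightarrow> 'p fm set" where
  "boolean_atoms (Var p) = {Var p}"
| "boolean_atoms (\<^bold>\<not> \<phi>) = boolean_atoms \<phi>"
| "boolean_atoms (\<phi> \<^bold>\<and> \<psi>) = boolean_atoms \<phi> \<union> boolean_atoms \<psi>"
| "boolean_atoms (Ign \<phi>) = {Ign \<phi>}"
| "boolean_atoms (IgnR \<phi>) = {IgnR \<phi>}"

lemma finite_boolean_atoms: "finite (boolean_atoms \<phi>)"
  by (induction \<phi>) auto

lemma pl_inst_abs: "(\<And>\<psi>. \<psi> \<in> boolean_atoms \<phi> \<Longrightarrow> \<sigma> (f \<psi>) = \<psi>) \<Longrightarrow> pl_inst \<sigma> (pl_abs f \<phi>) = \<phi>"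
  by (induction \<phi>) auto

lemma boolean_hom_eval_abs: "boolean_hom (\<lambda>\<phi>. pl_eval v (pl_abs f \<phi>))"
  by (simp add: boolean_hom_def)

abbreviation IRIT_theorem :: "'p fm \<Rightarrow> bool"  (\<open>\<turnstile> _\<close> [50] 50) where
  "\<turnstile> \<phi> \<equiv> thm_from IRIT_axiom \<phi>"

text \<open>Turns semantic Boolean reasoning into derivability. The letters of \<open>pl\<close> are
  natural numbers while \<open>'p\<close> may be uncountable, so only the finitely many atoms of
  \<open>\<phi>\<close> are numbered.\<close>

lemma theorem_if_boolean_valid:
  fixes \<phi> :: "'p fm"
  assumes "\<And>h. boolean_hom h \<Longrightarrow> h \<phi>"
  shows "\<turnstile> \<phi>"
proof -
  obtain f :: "'p fm \<Rightarrow> nat" where f: "inj_on f (boolean_atoms \<phi>)"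
    using finite_imp_inj_to_nat_seg[OF finite_boolean_atoms] by blast
  let ?\<sigma> = "inv_into (boolean_atoms \<phi>) f"
  \<comment> \<open>Every valuation \<open>v\<close>, composed with \<open>pl_abs f\<close>, is
    itself a Boolean homomorphism.\<close>
  have "pl_tautology (pl_abs f \<phi>)"
    using assms[OF boolean_hom_eval_abs] by (auto simp: pl_tautology_def)
  then have "\<turnstile> pl_inst ?\<sigma> (pl_abs f \<phi>)"
    by (intro thm_from.Axiom IRIT_axiom.IRIK IRIK_axiom.Taut)
  then show ?thesis
    using f by (simp add: pl_inst_abs)
qed

lemma theorem_boolean_consequence:
  assumes "\<turnstile> \<phi>" and "\<And>h. boolean_hom h \<Longrightarrow> h \<phi> \<Longrightarrow> h \<psi>"
  shows "\<turnstile> \<psi>"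
  by (rule thm_from.MP[OF theorem_if_boolean_valid assms(1)]) (simp add: assms(2))

lemma theorem_boolean_consequence2:
  assumes "\<turnstile> \<phi>" "\<turnstile> \<psi>" and "\<And>h. boolean_hom h \<Longrightarrow> h \<phi> \<Longrightarrow> h \<psi> \<Longrightarrow> h \<chi>"
  shows "\<turnstile> \<chi>"
  by (rule thm_from.MP[OF thm_from.MP[OF theorem_if_boolean_valid assms(1)] assms(2)])
    (simp add: assms(3))

section \<open>Maximal consistent sets\<close>

lemma derives_member: "\<phi> \<in> \<Gamma> \<Longrightarrow> \<Gamma> \<turnstile>\<^sub>I\<^sub>R\<^sub>I\<^sub>T \<phi>"
  unfolding derives_IRIT_def
  by (intro exI[of _ "[\<phi>]"]) (auto intro: theorem_if_boolean_valid)

lemma derives_theorem: "\<turnstile> \<phi> \<Longrightarrow> \<Gamma> \<turnstile>\<^sub>I\<^sub>R\<^sub>I\<^sub>T \<phi>"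
  unfolding derives_IRIT_def
  by (intro exI[of _ "[]"] conjI, simp, erule theorem_boolean_consequence) simp

lemma derives_boolean_consequence2:
  assumes "\<Gamma> \<turnstile>\<^sub>I\<^sub>R\<^sub>I\<^sub>T \<phi>" "\<Gamma> \<turnstile>\<^sub>I\<^sub>R\<^sub>I\<^sub>T \<psi>" and "\<And>h. boolean_hom h \<Longrightarrow> h \<phi> \<Longrightarrow> h \<psi> \<Longrightarrow> h \<chi>"
  shows "\<Gamma> \<turnstile>\<^sub>I\<^sub>R\<^sub>I\<^sub>T \<chi>"
proof -
  obtain as bs where sub: "set as \<subseteq> \<Gamma>" "set bs \<subseteq> \<Gamma>"
    and thms: "\<turnstile> Conj as \<^bold>\<longrightarrow> \<phi>" "\<turnstile> Conj bs \<^bold>\<longrightarrow> \<psi>"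
    using assms(1,2) by (auto simp: derives_IRIT_def)
  have "\<turnstile> Conj (as @ bs) \<^bold>\<longrightarrow> \<chi>"
    by (rule theorem_boolean_consequence2[OF thms]) (auto simp: assms(3))
  then show ?thesis
    using sub unfolding derives_IRIT_def by (intro exI[of _ "as @ bs"]) auto
qed

text \<open>The deduction theorem: all occurrences of \<open>\<psi>\<close> are removed from the
  premise list.\<close>

lemma derives_insert:
  assumes "insert \<psi> \<Gamma> \<turnstile>\<^sub>I\<^sub>R\<^sub>I\<^sub>T \<phi>"
  shows "\<Gamma> \<turnstile>\<^sub>I\<^sub>R\<^sub>I\<^sub>T \<psi> \<^bold>\<longrightarrow> \<phi>"
proof -
  obtain as where sub: "set as \<subseteq> insert \<psi> \<Gamma>" and "\<turnstile> Conj as \<^bold>\<longrightarrow> \<phi>"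
    using assms by (auto simp: derives_IRIT_def)
  from this(2) have "\<turnstile> Conj (filter (\<lambda>a. a \<noteq> \<psi>) as) \<^bold>\<longrightarrow> (\<psi> \<^bold>\<longrightarrow> \<phi>)"
    by (rule theorem_boolean_consequence) auto
  then show ?thesis
    using sub unfolding derives_IRIT_def by (intro exI[of _ "filter (\<lambda>a. a \<noteq> \<psi>) as"]) auto
qed

text \<open>The homomorphism property makes exactly one of each formula and its negation a member;
  together with containing all theorems this amounts to maximal consistency.\<close>

definition mcs :: "'p fm set \<Rightarrow> bool" where
  "mcs s \<longleftrightarrow> boolean_hom (\<lambda>\<phi>. \<phi> \<in> s) \<and> (\<forall>\<phi>. \<turnstile> \<phi> \<longrightarrow> \<phi> \<in> s)"

lemma mcs_Neg [simp]: "mcs s \<Longrightarrow> \<^bold>\<not> \<phi> \<in> s \<longleftrightarrow> \<phi> \<notin> s"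
  and mcs_And [simp]: "mcs s \<Longrightarrow> \<phi> \<^bold>\<and> \<psi> \<in> s \<longleftrightarrow> \<phi> \<in> s \<and> \<psi> \<in> s"
  and mcs_Conj [simp]: "mcs s \<Longrightarrow> Conj \<phi>s \<in> s \<longleftrightarrow> (\<forall>\<phi>\<in>set \<phi>s. \<phi> \<in> s)"
  and mcs_theorem: "mcs s \<Longrightarrow> \<turnstile> \<phi> \<Longrightarrow> \<phi> \<in> s"
  using boolean_hom_Neg[of "\<lambda>\<phi>. \<phi> \<in> s"] boolean_hom_And[of "\<lambda>\<phi>. \<phi> \<in> s"]
    boolean_hom_Conj[of "\<lambda>\<phi>. \<phi> \<in> s"]
  by (auto simp: mcs_def)

lemma mcs_axiom: "mcs s \<Longrightarrow> IRIT_axiom \<phi> \<Longrightarrow> \<phi> \<in> s"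
  by (simp add: mcs_theorem thm_from.Axiom)

text \<open>Zorn's lemma handles uncountable languages. Maximality is taken among the extensions of
  \<open>\<Gamma>\<close> that do not derive \<open>\<phi>\<close>.\<close>

lemma lindenbaum:
  assumes "\<not> \<Gamma> \<turnstile>\<^sub>I\<^sub>R\<^sub>I\<^sub>T \<phi>"
  obtains s where "mcs s" "\<Gamma> \<subseteq> s" "\<phi> \<notin> s"
proof -
  let ?A = "{s. \<Gamma> \<subseteq> s \<and> \<not> s \<turnstile>\<^sub>I\<^sub>R\<^sub>I\<^sub>T \<phi>}"
  have "\<exists>M\<in>?A. \<forall>X\<in>?A. M \<subseteq> X \<longrightarrow> X = M"
  proof (rule subset_Zorn_nonempty)
    show "?A \<noteq> {}" using assms by auto
    fix C assume C: "C \<noteq> {}" "subset.chain ?A C"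
    then have chain: "C \<subseteq> ?A" "\<And>X Y. X \<in> C \<Longrightarrow> Y \<in> C \<Longrightarrow> X \<subseteq> Y \<or> Y \<subseteq> X"
      by (auto simp: subset_chain_def)
    have "\<not> \<Union>C \<turnstile>\<^sub>I\<^sub>R\<^sub>I\<^sub>T \<phi>"
    proof
      assume "\<Union>C \<turnstile>\<^sub>I\<^sub>R\<^sub>I\<^sub>T \<phi>"
      then obtain as where as: "set as \<subseteq> \<Union>C" "\<turnstile> Conj as \<^bold>\<longrightarrow> \<phi>"
        by (auto simp: derives_IRIT_def)
      \<comment> \<open>A derivation uses finitely many premises, so one member of the chain
        contains them all.\<close>
      then obtain X where "X \<in> C" "set as \<subseteq> X"
        using finite_subset_Union_chain[OF finite_set as(1) C] by blast
      then show False
        using as(2) chain(1) by (auto simp: derives_IRIT_def)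
    qed
    then show "\<Union>C \<in> ?A" using C(1) chain(1) by auto
  qed
  then obtain s where s: "\<Gamma> \<subseteq> s" "\<not> s \<turnstile>\<^sub>I\<^sub>R\<^sub>I\<^sub>T \<phi>"
    and maximal: "\<And>X. s \<subseteq> X \<Longrightarrow> \<not> X \<turnstile>\<^sub>I\<^sub>R\<^sub>I\<^sub>T \<phi> \<Longrightarrow> X = s"
    by (smt (verit) mem_Collect_eq order_trans)
  have out: "s \<turnstile>\<^sub>I\<^sub>R\<^sub>I\<^sub>T \<psi> \<^bold>\<longrightarrow> \<phi>" if "\<psi> \<notin> s" for \<psi>
    using maximal[of "insert \<psi> s"] that by (auto intro: derives_insert)
  have closed: "\<psi> \<in> s" if "s \<turnstile>\<^sub>I\<^sub>R\<^sub>I\<^sub>T \<psi>" for \<psi>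
    using derives_boolean_consequence2[OF that out, of \<psi> \<phi>] s(2) by auto
  have closed2: "\<chi> \<in> s" if "\<alpha> \<in> s" "\<beta> \<in> s" "\<And>h. boolean_hom h \<Longrightarrow> h \<alpha> \<Longrightarrow> h \<beta> \<Longrightarrow> h \<chi>" for \<alpha> \<beta> \<chi>
    using closed derives_boolean_consequence2[OF derives_member derives_member] that by blast
  have "\<phi> \<notin> s"
    using s(2) derives_member by blast
  have "boolean_hom (\<lambda>\<phi>. \<phi> \<in> s)"
    unfolding boolean_hom_def
  proof (intro conjI allI iffI notI)
    fix \<psi> assume "\<^bold>\<not> \<psi> \<in> s" "\<psi> \<in> s"
    then have "\<phi> \<in> s" by (rule closed2) simp
    then show False using \<open>\<phi> \<notin> s\<close> by simp
  next
    fix \<psi> assume "\<psi> \<notin> s"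
    show "\<^bold>\<not> \<psi> \<in> s"
    proof (rule ccontr)
      assume "\<^bold>\<not> \<psi> \<notin> s"
      then have "s \<turnstile>\<^sub>I\<^sub>R\<^sub>I\<^sub>T \<phi>"
        using derives_boolean_consequence2[OF out[OF \<open>\<psi> \<notin> s\<close>] out, of "\<^bold>\<not> \<psi>" \<phi>] by auto
      then show False using s(2) by simp
    qed
  next
    fix \<psi> \<chi> assume "\<psi> \<^bold>\<and> \<chi> \<in> s"
    then show "\<psi> \<in> s" "\<chi> \<in> s" using closed2 boolean_hom_And by metis+
  next
    fix \<psi> \<chi> assume "\<psi> \<in> s \<and> \<chi> \<in> s"
    then show "\<psi> \<^bold>\<and> \<chi> \<in> s" using closed2 boolean_hom_And by metis
  qed
  then have "mcs s"
    by (auto simp: mcs_def intro: closed derives_theorem)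
  then show thesis
    using that s(1) \<open>\<phi> \<notin> s\<close> by blast
qed

section \<open>Soundness\<close>

text \<open>Properness validates \<open>I_IR\<close>: a \<open>rel\<close>-successor refuting
  \<open>Ign \<phi>\<close> is also a \<open>brel\<close>-successor. Reflexivity validates
  \<open>T\<close>: the state itself witnesses \<open>\<phi>\<close>.\<close>

lemma axiom_sound:
  assumes "IRIT_axiom \<phi>" and "F \<in> reflexive_proper_biframes" and "s \<in> states F"
  shows "truth F V s \<phi>"
  using assms(1)
proof cases
  case IRIK
  have "rel F \<subseteq> brel F"
    using assms(2) by (simp add: reflexive_proper_biframes_def proper_def)
  with IRIK show ?thesis
    by cases (auto simp: pl_tautology_def boolean_hom_pl_inst[OF boolean_hom_truth])
next
  case T
  have "(s, s) \<in> rel F"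
    using assms(2,3) by (auto simp: reflexive_proper_biframes_def reflexive_def refl_on_def)
  with T show ?thesis by auto
qed

lemma theorem_sound:
  assumes "\<turnstile> \<phi>" and "F \<in> reflexive_proper_biframes" and "s \<in> states F"
  shows "truth F V s \<phi>"
  using assms(1,3)
proof (induction arbitrary: s)
  case (Mix \<chi>s \<phi>)
  have "brel F \<subseteq> states F \<times> states F"
    using assms(2) by (simp add: reflexive_proper_biframes_def is_biframe_def)
  \<comment> \<open>The antecedent forces each \<open>Ign \<chi>\<close> at every
    \<open>brel\<close>-successor; the premise of the rule, applied there, yields
    \<open>Ign \<phi>\<close>, which refutes \<open>IgnR \<phi>\<close>.\<close>
  then show ?case
    using Mix.IH by (auto simp: boolean_hom_Conj[OF boolean_hom_truth] simp del: truth.simps(4))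
next
  case (Not_I \<phi>)
  then show ?case
    using assms(2) by (auto simp: reflexive_proper_biframes_def is_biframe_def)
next
  case (I_cong \<phi> \<psi>)
  have "rel F \<subseteq> states F \<times> states F"
    using assms(2) by (simp add: reflexive_proper_biframes_def is_biframe_def)
  then show ?case
    using I_cong.IH by auto
next
  case (IR_cong \<phi> \<psi>)
  have sub: "rel F \<subseteq> states F \<times> states F" "brel F \<subseteq> states F \<times> states F"
    using assms(2) by (simp_all add: reflexive_proper_biframes_def is_biframe_def)
  have "truth F V t (Ign \<phi>) \<longleftrightarrow> truth F V t (Ign \<psi>)" if "t \<in> states F" for t
    using IR_cong.IH sub(1) by auto
  then show ?case
    using sub(2) IR_cong.prems by (auto simp del: truth.simps(4))
qed (auto intro: axiom_sound assms(2))

lemma soundness: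
  assumes "\<Gamma> \<turnstile>\<^sub>I\<^sub>R\<^sub>I\<^sub>T \<phi>"
  shows "\<Gamma> \<TTurnstile>\<^bsub>reflexive_proper_biframes\<^esub> \<phi>"
proof -
  obtain as where "set as \<subseteq> \<Gamma>" "\<turnstile> Conj as \<^bold>\<longrightarrow> \<phi>"
    using assms by (auto simp: derives_IRIT_def)
  then show ?thesis
    using theorem_sound[of "Conj as \<^bold>\<longrightarrow> \<phi>"]
    by (fastforce simp: consequence_def boolean_hom_Conj[OF boolean_hom_truth])
qed

section \<open>The canonical model\<close>

definition necessary :: "'p fm set \<Rightarrow> 'p fm set" where
  "necessary s = {\<phi> \<in> s. Ign \<phi> \<notin> s}"

definition robust :: "'p fm set \<Rightarrow> 'p fm set" where
  "robust s = {Ign \<chi> | \<chi>. Ign \<chi> \<in> s \<and> IgnR \<chi> \<notin> s}"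

definition canonical :: "'p fm set biframe" where
  "canonical = \<lparr>states = {s. mcs s},
     rel = {(s, t). mcs s \<and> mcs t \<and> necessary s \<subseteq> t},
     brel = {(s, t). mcs s \<and> mcs t \<and> robust s \<subseteq> t}\<rparr>"

definition canonical_val :: "'p \<Rightarrow> 'p fm set set" where
  "canonical_val p = {s. mcs s \<and> Var p \<in> s}"

lemma mcs_Ign_Neg:
  assumes "mcs s"
  shows "Ign (\<^bold>\<not> \<phi>) \<in> s \<longleftrightarrow> Ign \<phi> \<in> s"
  using mcs_axiom[OF assms IRIT_axiom.IRIK[OF IRIK_axiom.I_neg[of \<phi>]]] assms by auto

lemma necessary_mono:
  assumes "mcs s" and "\<phi> \<in> necessary s" and "\<turnstile> \<phi> \<^bold>\<longrightarrow> \<psi>"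
  shows "\<psi> \<in> necessary s"
proof -
  have "\<turnstile> (\<phi> \<^bold>\<or> \<psi>) \<^bold>\<longleftrightarrow> \<psi>"
    using assms(3) by (rule theorem_boolean_consequence) auto
  then have "(Ign (\<phi> \<^bold>\<or> \<psi>) \<^bold>\<longleftrightarrow> Ign \<psi>) \<in> s"
    by (intro mcs_theorem[OF assms(1)] thm_from.I_cong)
  then show ?thesis
    using mcs_theorem[OF assms(1,3)] mcs_axiom[OF assms(1) IRIT_axiom.T[of \<phi> \<psi>]] assms(1,2)
    by (auto simp: necessary_def)
qed

lemma necessary_And:
  assumes "mcs s" and "\<phi> \<in> necessary s" and "\<psi> \<in> necessary s"
  shows "\<phi> \<^bold>\<and> \<psi> \<in> necessary s"
  using mcs_axiom[OF assms(1) IRIT_axiom.IRIK[OF IRIK_axiom.I_and[of \<phi> \<psi>]]] assms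
  by (auto simp: necessary_def)

lemma necessary_Conj:
  assumes "mcs s" and "set \<phi>s \<subseteq> necessary s"
  shows "Conj \<phi>s \<in> necessary s"
  using assms(2)
proof (induction \<phi>s rule: Conj.induct)
  \<comment> \<open>The empty conjunction \<open>Top\<close> is necessary by the rule
    \<open>Not_I\<close>, which acts as necessitation.\<close>
  case 1
  have "\<turnstile> Top" by (rule theorem_if_boolean_valid) simp
  then show ?case
    using mcs_theorem[OF assms(1)] thm_from.Not_I assms(1) by (fastforce simp: necessary_def)
qed (auto intro: necessary_And[OF assms(1)])

text \<open>If \<open>necessary s\<close> derived \<open>\<phi>\<close>, closure under conjunction
  and provable implication would make \<open>\<phi>\<close> necessary.\<close>

lemma necessary_witness:
  assumes "mcs s" and "\<phi> \<notin> necessary s"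
  obtains t where "mcs t" "necessary s \<subseteq> t" "\<phi> \<notin> t"
proof -
  have "\<not> necessary s \<turnstile>\<^sub>I\<^sub>R\<^sub>I\<^sub>T \<phi>"
    using assms necessary_mono necessary_Conj unfolding derives_IRIT_def by blast
  then show thesis using lindenbaum that by blast
qed

lemma robust_witness:
  assumes "mcs s" and "IgnR \<phi> \<in> s"
  obtains t where "mcs t" "robust s \<subseteq> t" "Ign \<phi> \<notin> t"
proof -
  have "\<not> robust s \<turnstile>\<^sub>I\<^sub>R\<^sub>I\<^sub>T Ign \<phi>"
  proof
    assume "robust s \<turnstile>\<^sub>I\<^sub>R\<^sub>I\<^sub>T Ign \<phi>"
    then obtain as where as: "set as \<subseteq> robust s" "\<turnstile> Conj as \<^bold>\<longrightarrow> Ign \<phi>"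
      by (auto simp: derives_IRIT_def)
    \<comment> \<open>Membership in \<open>lists\<close> of an image allows the arguments
      \<open>\<chi>s\<close> to be read off as a list, as \<open>Mix\<close> requires.\<close>
    have "as \<in> lists (Ign ` {\<chi>. Ign \<chi> \<in> s \<and> IgnR \<chi> \<notin> s})"
      using as(1) by (auto simp: robust_def)
    then obtain \<chi>s where \<chi>s: "as = map Ign \<chi>s" "\<forall>\<chi>\<in>set \<chi>s. Ign \<chi> \<in> s \<and> IgnR \<chi> \<notin> s"
      by (auto simp: lists_image)
    have "Conj (map (\<lambda>\<chi>. \<^bold>\<not> IgnR \<chi> \<^bold>\<and> Ign \<chi>) \<chi>s) \<^bold>\<longrightarrow> \<^bold>\<not> IgnR \<phi> \<in> s"
      using mcs_theorem[OF assms(1)] thm_from.Mix as(2) \<chi>s(1) by blast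
    then show False
      using assms \<chi>s(2) by auto
  qed
  then show thesis using lindenbaum that by blast
qed

text \<open>Instantiating the side formula of \<open>I_IR\<close> with \<open>Ign \<chi>\<close>
  collapses its disjunction: ignorance of \<open>Ign \<chi>\<close> would give
  \<open>IgnR \<chi>\<close>. This is what makes the canonical frame proper.\<close>

lemma robust_subset_necessary:
  assumes "mcs s"
  shows "robust s \<subseteq> necessary s"
proof
  fix \<psi> assume "\<psi> \<in> robust s"
  then obtain \<chi> where \<chi>: "\<psi> = Ign \<chi>" "Ign \<chi> \<in> s" "IgnR \<chi> \<notin> s"
    by (auto simp: robust_def)
  have "\<turnstile> (Ign \<chi> \<^bold>\<or> Ign \<chi>) \<^bold>\<longleftrightarrow> Ign \<chi>"
    by (rule theorem_if_boolean_valid) auto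
  then have "(Ign (Ign \<chi> \<^bold>\<or> Ign \<chi>) \<^bold>\<longleftrightarrow> Ign (Ign \<chi>)) \<in> s"
    by (intro mcs_theorem[OF assms] thm_from.I_cong)
  then show "\<psi> \<in> necessary s"
    using mcs_axiom[OF assms IRIT_axiom.IRIK[OF IRIK_axiom.I_IR[of \<chi> "Ign \<chi>"]]] assms \<chi>
    by (auto simp: necessary_def)
qed

text \<open>The set \<open>s\<close> ensures that there is a state; reflexivity is immediate because
  \<open>necessary\<close> and \<open>robust\<close> only select members of a set.\<close>

lemma canonical_reflexive_proper:
  fixes s :: "'p fm set"
  assumes "mcs s"
  shows "(canonical :: 'p fm set biframe) \<in> reflexive_proper_biframes"
proof -
  have "necessary t \<subseteq> t" "robust t \<subseteq> t" for t :: "'p fm set"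
    by (auto simp: necessary_def robust_def)
  then have "is_biframe (canonical :: 'p fm set biframe)" "reflexive (canonical :: 'p fm set biframe)"
    using assms by (auto simp: is_biframe_def reflexive_def canonical_def refl_on_def)
  moreover have "proper (canonical :: 'p fm set biframe)"
    using robust_subset_necessary by (force simp: proper_def canonical_def)
  ultimately show ?thesis
    by (simp add: reflexive_proper_biframes_def)
qed

text \<open>\<open>Ign \<phi>\<close> means that neither \<open>\<phi>\<close> nor its negation is
  necessary, so each has a successor omitting it. Otherwise the one that lies in \<open>s\<close> is
  necessary, and all successors agree on \<open>\<phi>\<close>.\<close>

lemma mcs_Ign_iff:
  assumes "mcs s"
  shows "Ign \<phi> \<in> s \<longleftrightarrow>
    (\<exists>t. mcs t \<and> necessary s \<subseteq> t \<and> \<phi> \<in> t) \<and> (\<exists>u. mcs u \<and> necessary s \<subseteq> u \<and> \<phi> \<notin> u)"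
    (is "_ \<longleftrightarrow> ?R")
proof
  assume "Ign \<phi> \<in> s"
  then have "\<phi> \<notin> necessary s" "\<^bold>\<not> \<phi> \<notin> necessary s"
    using mcs_Ign_Neg[OF assms] by (auto simp: necessary_def)
  then show ?R
    using necessary_witness[OF assms] mcs_Neg by metis
next
  assume R: ?R
  show "Ign \<phi> \<in> s"
  proof (rule ccontr)
    assume "Ign \<phi> \<notin> s"
    then have "\<phi> \<in> necessary s \<or> \<^bold>\<not> \<phi> \<in> necessary s"
      using mcs_Ign_Neg[OF assms] assms by (auto simp: necessary_def)
    then show False using R by auto
  qed
qed

lemma mcs_IgnR_iff:
  assumes "mcs s"
  shows "IgnR \<phi> \<in> s \<longleftrightarrow> Ign \<phi> \<in> s \<and> (\<exists>t. mcs t \<and> robust s \<subseteq> t \<and> Ign \<phi> \<notin> t)"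
    (is "_ \<longleftrightarrow> ?R")
proof
  assume "IgnR \<phi> \<in> s"
  moreover from this have "Ign \<phi> \<in> s"
    using mcs_axiom[OF assms IRIT_axiom.IRIK[OF IRIK_axiom.IR_I[of \<phi>]]] assms by auto
  ultimately show ?R
    using robust_witness[OF assms] by blast
next
  assume ?R
  \<comment> \<open>Without \<open>IgnR \<phi>\<close> in \<open>s\<close>,
    \<open>Ign \<phi>\<close> would be robust and hence belong to \<open>t\<close>.\<close>
  then show "IgnR \<phi> \<in> s" by (auto simp: robust_def)
qed

lemma truth_lemma: "mcs s \<Longrightarrow> truth canonical canonical_val s \<phi> \<longleftrightarrow> \<phi> \<in> s"
proof (induction \<phi> arbitrary: s)
  case (Var p)
  then show ?case by (simp add: canonical_val_def)
next
  case (Ign \<phi>)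
  then show ?case by (auto simp: canonical_def mcs_Ign_iff)
next
  case (IgnR \<phi>)
  \<comment> \<open>The induction hypothesis concerns \<open>\<phi>\<close> only, while the truth
    clause for \<open>IgnR \<phi>\<close> mentions \<open>Ign \<phi>\<close>, so that case is
    established again.\<close>
  have "truth canonical canonical_val t (Ign \<phi>) \<longleftrightarrow> Ign \<phi> \<in> t" if "mcs t" for t
    using IgnR.IH that by (auto simp: canonical_def mcs_Ign_iff)
  then show ?case
    using IgnR.prems by (auto simp: canonical_def mcs_IgnR_iff simp del: truth.simps(4))
qed simp_all

lemma completeness:
  fixes \<Gamma> :: "'p fm set"
  assumes "\<Gamma> \<TTurnstile>\<^bsub>(reflexive_proper_biframes :: 'p fm set biframe set)\<^esub> \<phi>"
  shows "\<Gamma> \<turnstile>\<^sub>I\<^sub>R\<^sub>I\<^sub>T \<phi>"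
proof (rule ccontr)
  assume "\<not> \<Gamma> \<turnstile>\<^sub>I\<^sub>R\<^sub>I\<^sub>T \<phi>"
  then obtain s where s: "mcs s" "\<Gamma> \<subseteq> s" "\<phi> \<notin> s" by (rule lindenbaum)
  have "is_valuation canonical canonical_val" "s \<in> states canonical"
    using s(1) by (auto simp: is_valuation_def canonical_def canonical_val_def)
  then have "truth canonical canonical_val s \<phi>"
    using assms canonical_reflexive_proper[OF s(1)] s(2) truth_lemma[OF s(1)]
    unfolding consequence_def by blast
  then show False using s truth_lemma by blast
qed

text \<open>Countermodels live on sets of formulas, so consequence over this one state type already
  gives derivability; the second conjunct extends soundness to frames over any type
  \<open>'s\<close>.\<close>

theorem theorem25:
  fixes \<Gamma> :: "'p fm set" and \<phi> :: "'p fm"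
  shows "(\<Gamma> \<turnstile>\<^sub>I\<^sub>R\<^sub>I\<^sub>T \<phi> \<longleftrightarrow> \<Gamma> \<TTurnstile>\<^bsub>(reflexive_proper_biframes :: 'p fm set biframe set)\<^esub> \<phi>)
    \<and> (\<Gamma> \<turnstile>\<^sub>I\<^sub>R\<^sub>I\<^sub>T \<phi> \<longrightarrow> \<Gamma> \<TTurnstile>\<^bsub>(reflexive_proper_biframes :: 's biframe set)\<^esub> \<phi>)"
  by (intro conjI iffI impI soundness) (auto intro: completeness)

end
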